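(* Let $S$ be a packing sequence and $C_n$ a cycle with $n\ge 3$. (i) If $S\in\mathcal{S}_{1,2,4,4}$ or $S\in\mathcal{S}_{1,3,4,4}$, then $C_n$ is $\chi_S$-vertex-critical if and only if $n\le 9$. (ii) If $S\in\mathcal{S}_{1,2,\overline{4},5}$, then $C_n$ is $\chi_S$-vertex-critical if and only if $n\le 11$ or $n=17$. (iii) If $S\in\mathcal{S}_{1,2,\overline{4},6}$, then $C_n$ is $\chi_S$-vertex-critical if and only if $n\le 13$ or $n\in\{17,18,19,20,25,26,27,33,34,41\}$. (iv) If $S\in\mathcal{S}_{1,3,4,5}$, then $C_n$ is $\chi_S$-vertex-critical if and only if $n\le 11$ or $n\in\{15,17,23\}$. (v) If $S\in\mathcal{S}_{1,3,5,5}$, then $C_n$ is $\chi_S$-vertex-critical if and only if $n\le 10$ or $n$ is odd. (vi) If $S\in\mathcal{S}_{1,2,\overline{4},7}\cup\mathcal{S}_{1,3,\overline{4},7}\cup\mathcal{S}_{1,3,\overline{5},6}$, then $C_n$ is $\chi_S$-vertex-critical if and only if $n\not\equiv 0\pmod 8$ or $n=8$.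
   Context: A packing sequence is a non-decreasing infinite sequence $S=(s_1,s_2,\ldots)$ of positive integers. For a graph $G$, a map $\phi\colon V(G)\to\{1,\ldots,k\}$ is an $S$-packing $k$-coloring if any two distinct vertices $u,v$ with $\phi(u)=\phi(v)=i$ satisfy $d_G(u,v) > s_i$; $\chi_S(G)$ is the least such $k$. A graph $G$ is $\chi_S$-vertex-critical if $\chi_S(G-v)<\chi_S(G)$ for every $v\in V(G)$. Notation: $\mathcal{S}_{a_1,\ldots,a_m}$ is the set of packing sequences with $s_j=a_j$ for $j\le m$ (later entries arbitrary subject to being a packing sequence); $\mathcal{S}_{a_1,a_2,\overline{a_3},a_4}$ is the set of packing sequences with $s_1=a_1$, $s_2=a_2$, $a_3\le s_3\le a_4$, $s_4=a_4$. *)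

theory Defs
  imports "Graph_Theory.Graph_Theory"
begin

text \<open>
  Packing sequences are indexed from 1, as usual in the literature on packing colorings; the
  value at 0 is never used. Graphs are symmetric digraphs, following the theory
  \<^theory>\<open>Graph_Theory.Digraph\<close>.
\<close>

definition packing_sequence :: "(nat \<Rightarrow> nat) \<Rightarrow> bool" where
  "packing_sequence S \<longleftrightarrow> (\<forall>i\<ge>1. 0 < S i) \<and> mono_on {1..} S"

text \<open>The class written \<open>S\<^sub>a\<^sub>1\<^sub>,\<^sub>\<dots>\<^sub>,\<^sub>a\<^sub>m\<close>, for the list \<open>as = [a\<^sub>1, \<dots>, a\<^sub>m]\<close>.\<close>

definition seqs_with_prefix :: "nat list \<Rightarrow> (nat \<Rightarrow> nat) set" where
  "seqs_with_prefix as =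
     {S. packing_sequence S \<and> (\<forall>j\<in>{1..length as}. S j = as ! (j - 1))}"

text \<open>The same with a bar over \<open>a\<^sub>3\<close>, which leaves the third entry free between \<open>a\<^sub>3\<close> and \<open>a\<^sub>4\<close>.\<close>

definition seqs_with_barred_prefix :: "nat \<Rightarrow> nat \<Rightarrow> nat \<Rightarrow> nat \<Rightarrow> (nat \<Rightarrow> nat) set" where
  "seqs_with_barred_prefix a1 a2 a3 a4 =
     {S. packing_sequence S \<and> S 1 = a1 \<and> S 2 = a2 \<and> a3 \<le> S 3 \<and> S 3 \<le> a4 \<and> S 4 = a4}"

text \<open>Every arc has weight 1; vertices in different components are at distance \<open>\<infinity>\<close>.\<close>

definition graph_dist :: "('a, 'b) pre_digraph \<Rightarrow> 'a \<Rightarrow> 'a \<Rightarrow> ereal" where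
  "graph_dist G u v = wf_digraph.\<mu> G (\<lambda>_. 1) u v"

definition packing_coloring ::
    "(nat \<Rightarrow> nat) \<Rightarrow> ('a, 'b) pre_digraph \<Rightarrow> nat \<Rightarrow> ('a \<Rightarrow> nat) \<Rightarrow> bool" where
  "packing_coloring S G k \<phi> \<longleftrightarrow>
     \<phi> \<in> verts G \<rightarrow> {1..k} \<and>
     (\<forall>u\<in>verts G. \<forall>v\<in>verts G. \<forall>i. u \<noteq> v \<longrightarrow> \<phi> u = i \<longrightarrow> \<phi> v = i \<longrightarrow>
        graph_dist G u v > ereal (real (S i)))"

definition packing_chromatic_number :: "(nat \<Rightarrow> nat) \<Rightarrow> ('a, 'b) pre_digraph \<Rightarrow> nat" where
  "packing_chromatic_number S G = (LEAST k. \<exists>\<phi>. packing_coloring S G k \<phi>)"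

definition packing_vertex_critical :: "(nat \<Rightarrow> nat) \<Rightarrow> ('a, 'b) pre_digraph \<Rightarrow> bool" where
  "packing_vertex_critical S G \<longleftrightarrow>
     (\<forall>v\<in>verts G.
        packing_chromatic_number S (pre_digraph.del_vert G v) < packing_chromatic_number S G)"

definition cycle_graph :: "nat \<Rightarrow> nat pair_pre_digraph" where
  "cycle_graph n =
     \<lparr> pverts = {0..<n},
       parcs = {(i, j). i < n \<and> j < n \<and> (j = Suc i mod n \<or> i = Suc j mod n)} \<rparr>"

lemma pair_graph_cycle_graph:
  assumes "n \<ge> 3"
  shows "pair_graph (cycle_graph n)"
proof
  have "parcs (cycle_graph n) \<subseteq> {0..<n} \<times> {0..<n}"
    by (auto simp: cycle_graph_def)
  then show "finite (parcs (cycle_graph n))"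
    by (rule finite_subset) simp
  show "symmetric (cycle_graph n)"
    by (auto simp: symmetric_def cycle_graph_def intro!: symI)
  fix e assume "e \<in> parcs (cycle_graph n)"
  moreover have "i \<noteq> Suc i mod n" if "i < n" for i
    using assms that by (cases "Suc i = n") auto
  ultimately show "fst e \<noteq> snd e"
    by (auto simp: cycle_graph_def) metis+
qed (auto simp: cycle_graph_def)

lemma wf_digraph_cycle_graph_del_vert:
  assumes "n \<ge> 3"
  shows "wf_digraph (pre_digraph.del_vert (with_proj (cycle_graph n)) v)"
proof -
  interpret pair_graph "cycle_graph n"
    by (rule pair_graph_cycle_graph[OF assms])
  show ?thesis by (rule wf_digraph_del_vert)
qed

text \<open>An injective coloring is a packing coloring, so the least number of colors exists.\<close>

lemma packing_coloring_exists:
  assumes "finite (verts G)"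
  shows "\<exists>k \<phi>. packing_coloring S G k \<phi>"
proof -
  obtain f where f: "bij_betw f (verts G) {1..card (verts G)}"
    using assms finite_same_card_bij[of "verts G" "{1..card (verts G)}"] by auto
  then have "packing_coloring S G (card (verts G)) f"
    by (auto simp: packing_coloring_def bij_betw_def inj_on_def)
  then show ?thesis by blast
qed

end

theory Submission
  imports Defs
begin

text \<open>
  Deleting a vertex of \<open>C\<^sub>n\<close> leaves a path, which a factor of the periodic word
  \<open>(4 1 2 1 3 1 2 1)\<close> always colors with four colors; three colors suffice exactly when the path has
  at most seven vertices. Hence for \<open>n \<ge> 9\<close> the cycle is critical iff it has no 4-coloring.

  Colors 1 and 2 alone cover at most three consecutive vertices and colors 1, 2, 3 at most seven, so
  in a 4-coloring of a long cycle the colors 3 and 4 alternate, cutting the cycle into blocks of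
  length at most four. Two consecutive blocks starting at a 4 have total length between
  \<open>s\<^sub>4 + 1\<close> and 8, so \<open>n\<close> lies between \<open>(s\<^sub>4 + 1) m\<close> and \<open>8 m\<close> for some \<open>m\<close>. If \<open>s\<^sub>2 = 3\<close>, a block
  of length three cannot have two neighbors of length at least three; this gives the parity and
  divisibility obstructions. The remaining lengths are realized by concatenating cyclic words with
  a common prefix of length \<open>s\<^sub>4\<close>.
\<close>

subsection \<open>Distances and walks\<close>

text \<open>Walk lengths are integers, so each is at least \<open>s + 1\<close>. This bound passes
  to the infimum, keeps the inequality strict and covers the case of no walk at all.\<close>

lemma graph_dist_gt:
  assumes "wf_digraph G"
    and "\<And>p. pre_digraph.awalk G u p v \<Longrightarrow> s < length p"
  shows "graph_dist G u v > ereal (real s)"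
proof -
  interpret wf_digraph G by fact
  have "awalk_cost (\<lambda>_. 1) p = real (length p)" for p :: "'b list"
    by (simp add: awalk_cost_def sum_list_triv)
  then have "ereal (real (Suc s)) \<le> \<mu> (\<lambda>_. 1) u v"
    unfolding \<mu>_def using assms(2) by (auto intro!: INF_greatest Suc_leI simp del: of_nat_Suc)
  moreover have "ereal (real s) < ereal (real (Suc s))"
    by simp
  ultimately show ?thesis
    unfolding graph_dist_def by (rule less_le_trans[rotated])
qed

lemma graph_dist_le:
  assumes "wf_digraph G" and "f 0 \<in> verts G"
    and "\<And>j. j < d \<Longrightarrow> (f j, f (Suc j)) \<in> arcs_ends G"
  shows "graph_dist G (f 0) (f d) \<le> ereal (real d)"
proof -
  interpret wf_digraph G by fact
  have "\<exists>p. awalk (f 0) p (f d) \<and> length p = d"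
    using assms(3)
  proof (induction d)
    case 0
    then show ?case
      using assms(2) by (auto simp: awalk_Nil_iff)
  next
    case (Suc d)
    then obtain p where p: "awalk (f 0) p (f d)" "length p = d"
      by fastforce
    obtain e where "e \<in> arcs G" "tail G e = f d" "head G e = f (Suc d)"
      using Suc.prems[of d] by (auto simp: arcs_ends_conv)
    then have "awalk (f d) [e] (f (Suc d))"
      using arc_implies_awalk by metis
    with p have "awalk (f 0) (p @ [e]) (f (Suc d))"
      by (blast intro: awalk_appendI)
    with p(2) show ?case
      by (intro exI[of _ "p @ [e]"]) simp
  qed
  then obtain p where p: "awalk (f 0) p (f d)" "length p = d"
    by blast
  then have "awalk_cost (\<lambda>_. 1) p = real d"
    by (simp add: awalk_cost_def sum_list_triv)
  with min_cost_le_walk_cost[OF p(1), of "\<lambda>_. 1"] show ?thesis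
    by (simp add: graph_dist_def)
qed

text \<open>Each arc changes the potential \<open>f\<close> by at most 1. With the position along a
  path as \<open>f\<close>, this bounds distances in a punctured cycle from below.\<close>

lemma awalk_potential_bound:
  fixes f :: "'a \<Rightarrow> int"
  assumes "wf_digraph G" and "pre_digraph.awalk G u p v"
    and "\<And>x y. (x, y) \<in> arcs_ends G \<Longrightarrow> \<bar>f x - f y\<bar> \<le> 1"
  shows "\<bar>f u - f v\<bar> \<le> int (length p)"
proof -
  interpret wf_digraph G by fact
  show ?thesis
    using assms(2)
  proof (induction p arbitrary: u)
    case (Cons e p)
    then have "\<bar>f (head G e) - f v\<bar> \<le> int (length p)" "u = tail G e" "e \<in> arcs G"
      by (auto simp: awalk_Cons_iff)
    moreover have "\<bar>f (tail G e) - f (head G e)\<bar> \<le> 1"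
      using \<open>e \<in> arcs G\<close> by (intro assms(3)) (auto simp: arcs_ends_conv)
    ultimately show ?case
      by simp
  qed (auto simp: awalk_Nil_iff)
qed

lemma packing_coloring_mono:
  "packing_coloring S G k \<phi> \<Longrightarrow> k \<le> l \<Longrightarrow> packing_coloring S G l \<phi>"
  by (fastforce simp: packing_coloring_def)

lemma packing_chromatic_number_le_iff:
  assumes "finite (verts G)"
  shows "packing_chromatic_number S G \<le> k \<longleftrightarrow> (\<exists>\<phi>. packing_coloring S G k \<phi>)"
proof
  assume "packing_chromatic_number S G \<le> k"
  moreover have "\<exists>\<phi>. packing_coloring S G (packing_chromatic_number S G) \<phi>"
    unfolding packing_chromatic_number_def by (rule LeastI_ex) (rule packing_coloring_exists[OF assms])
  ultimately show "\<exists>\<phi>. packing_coloring S G k \<phi>"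
    by (blast intro: packing_coloring_mono)
qed (simp add: packing_chromatic_number_def Least_le)

subsection \<open>Colorings of cycles and of punctured cycles\<close>

lemma wf_cycle_graph: "n \<ge> 3 \<Longrightarrow> wf_digraph (with_proj (cycle_graph n))"
proof -
  assume "n \<ge> 3"
  then interpret pair_graph "cycle_graph n"
    by (rule pair_graph_cycle_graph)
  show ?thesis by (rule wf_digraph_axioms)
qed

lemma pverts_cycle_graph [simp]: "pverts (cycle_graph n) = {0..<n}"
  by (simp add: cycle_graph_def)

text \<open>Adjacency is moved to the integers so that a backward step becomes subtraction of 1
  modulo \<open>n\<close>.\<close>

lemma cycle_arc_iff:
  "(x, y) \<in> parcs (cycle_graph n) \<longleftrightarrow> x < n \<and> y < n \<and>
     (int y = (int x + 1) mod int n \<or> int x = (int y + 1) mod int n)"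
proof -
  have "j = Suc i mod n \<longleftrightarrow> int j = (int i + 1) mod int n" for i j
  proof -
    have "int (Suc i mod n) = (int i + 1) mod int n"
      by (simp add: zmod_int add.commute)
    then show ?thesis
      by (metis of_nat_eq_iff)
  qed
  then show ?thesis
    by (auto simp: cycle_graph_def)
qed

text \<open>Each arc adds 1 or -1 modulo \<open>n\<close>; \<open>k\<close> is the net displacement
  of the walk lifted to the integer line.\<close>

lemma cycle_awalk_offset:
  assumes "n \<ge> 3" and "pre_digraph.awalk (with_proj (cycle_graph n)) u p v"
  shows "\<exists>k. \<bar>k\<bar> \<le> int (length p) \<and> int v = (int u + k) mod int n"
proof -
  interpret wf_digraph "with_proj (cycle_graph n)"
    using wf_cycle_graph[OF assms(1)] .
  show ?thesis
    using assms(2)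
  proof (induction p arbitrary: u)
    case Nil
    then show ?case
      by (auto simp: awalk_Nil_iff)
  next
    case (Cons e p)
    obtain x y where e: "e = (x, y)"
      by (cases e)
    with Cons.prems have w: "awalk y p v" "u = x" "(x, y) \<in> parcs (cycle_graph n)"
      by (auto simp: awalk_Cons_iff)
    from Cons.IH[OF w(1)] obtain k where k: "\<bar>k\<bar> \<le> int (length p)" "int v = (int y + k) mod int n"
      by blast
    have "x < n" "y < n"
      using w(3) by (auto simp: cycle_arc_iff)
    from w(3) consider "int y = (int x + 1) mod int n" | "int x = (int y + 1) mod int n"
      by (auto simp: cycle_arc_iff)
    then show ?case
    proof cases
      case 1
      then have "int v = (int u + (k + 1)) mod int n"
        by (simp add: k(2) w(2) mod_simps algebra_simps)
      with k(1) show ?thesis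
        by (intro exI[of _ "k + 1"]) auto
    next
      case 2
      then have "(int x + (k - 1)) mod int n = (int y + 1 + (k - 1)) mod int n"
        by (simp only: mod_simps)
      then have "int v = (int u + (k - 1)) mod int n"
        by (simp add: k(2) w(2))
      with k(1) show ?thesis
        by (intro exI[of _ "k - 1"]) auto
    qed
  qed
qed

lemma cycle_graph_dist_le:
  assumes "n \<ge> 3"
  shows "graph_dist (with_proj (cycle_graph n)) (nat (i mod int n)) (nat ((i + int d) mod int n))
           \<le> ereal (real d)"
proof -
  let ?f = "\<lambda>j. nat ((i + int j) mod int n)"
  have "graph_dist (with_proj (cycle_graph n)) (?f 0) (?f d) \<le> ereal (real d)"
  proof (rule graph_dist_le[OF wf_cycle_graph[OF assms]])
    fix j assume "j < d"
    have "((i + int j) mod int n + 1) mod int n = (i + int (Suc j)) mod int n"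
      by (simp add: mod_simps algebra_simps)
    with assms show "(?f j, ?f (Suc j)) \<in> arcs_ends (with_proj (cycle_graph n))"
      by (simp add: cycle_arc_iff nat_less_iff)
  qed (use assms in \<open>simp add: nat_less_iff\<close>)
  then show ?thesis
    by simp
qed

text \<open>Colorings of a cycle are lifted to periodic maps on the integers. Positive
  \<open>d\<close> suffice: a clash at a negative offset is one at a positive offset seen from the
  other vertex, which has the same color.\<close>

definition packing_map :: "(nat \<Rightarrow> nat) \<Rightarrow> (int \<Rightarrow> nat) \<Rightarrow> bool" where
  "packing_map S c \<longleftrightarrow> (\<forall>i d. 0 < d \<longrightarrow> d \<le> int (S (c i)) \<longrightarrow> c (i + d) \<noteq> c i)"

lemma packing_coloring_cycleI:
  assumes n: "n \<ge> 3" and per: "\<And>i. c (i mod int n) = c i"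
    and c: "packing_map S c" "\<And>i. c i \<in> {1..k}"
  shows "packing_coloring S (with_proj (cycle_graph n)) k (c \<circ> int)"
  unfolding packing_coloring_def
proof (intro conjI ballI allI impI)
  fix u v i
  assume uv: "u \<in> verts (with_proj (cycle_graph n))" "v \<in> verts (with_proj (cycle_graph n))"
    "u \<noteq> v" "(c \<circ> int) u = i" "(c \<circ> int) v = i"
  show "ereal (real (S i)) < graph_dist (with_proj (cycle_graph n)) u v"
  proof (rule graph_dist_gt[OF wf_cycle_graph[OF n]])
    fix p assume "pre_digraph.awalk (with_proj (cycle_graph n)) u p v"
    from cycle_awalk_offset[OF n this] obtain l
      where l: "\<bar>l\<bar> \<le> int (length p)" "int v = (int u + l) mod int n"
      by blast
    then have eq: "c (int u + l) = i" "c (int u) = i"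
      using uv per[of "int u + l"] by auto
    have "l \<noteq> 0"
      using l uv by auto
    show "S i < length p"
    proof (rule ccontr)
      assume "\<not> S i < length p"
      then have "\<bar>l\<bar> \<le> int (S i)"
        using l by linarith
      \<comment> \<open>The offset \<open>l\<close> may have either sign; if it is negative, the
        clash is read from the other endpoint.\<close>
      moreover have "c (a + d) \<noteq> c a" if "c a = i" "0 < d" "d \<le> int (S i)" for a d
        using c(1) that by (auto simp: packing_map_def)
      note this[of "int u" l] this[of "int u + l" "- l"]
      ultimately show False
        using \<open>l \<noteq> 0\<close> eq by (cases "l < 0") auto
    qed
  qed
qed (use c in auto)

text \<open>At offset \<open>n\<close> the lift returns to the same vertex, so distances are capped
  at \<open>n - 1\<close>. Below the cap the two vertices differ and lie at distance at most
  \<open>d\<close>.\<close>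

lemma packing_coloring_cycleD:
  assumes n: "n \<ge> 3" and \<phi>: "packing_coloring S (with_proj (cycle_graph n)) k \<phi>"
  defines "c \<equiv> \<lambda>i. \<phi> (nat (i mod int n))"
  shows "packing_map (\<lambda>j. min (S j) (n - 1)) c" "\<And>i. c i \<in> {1..k}" "\<And>i. c (i + int n) = c i"
proof -
  have vert: "nat (i mod int n) \<in> {0..<n}" for i
    using n by (auto simp: nat_less_iff)
  show "c i \<in> {1..k}" for i
    using \<phi> vert[of i] by (auto simp: packing_coloring_def c_def Pi_iff)
  show "c (i + int n) = c i" for i
    by (simp add: c_def)
  show "packing_map (\<lambda>j. min (S j) (n - 1)) c"
    unfolding packing_map_def
  proof (intro allI impI notI)
    fix i d assume d: "0 < d" "d \<le> int (min (S (c i)) (n - 1))" "c (i + d) = c i"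
    let ?u = "nat (i mod int n)" and ?v = "nat ((i + int (nat d)) mod int n)"
    have "(i + d) mod int n \<noteq> i mod int n"
    proof
      assume "(i + d) mod int n = i mod int n"
      then have "int n dvd d"
        by (metis add_diff_cancel_left' mod_eq_dvd_iff)
      then have "int n \<le> d"
        using d by (intro zdvd_imp_le) auto
      then show False
        using d n by auto
    qed
    moreover have "0 \<le> (i + d) mod int n" "0 \<le> i mod int n"
      using n by auto
    ultimately have "?u \<noteq> ?v"
      using d(1) by (simp add: nat_eq_iff2)
    moreover have "\<phi> ?v = c i" "\<phi> ?u = c i"
      using d by (auto simp: c_def)
    ultimately have "ereal (real (S (c i))) < graph_dist (with_proj (cycle_graph n)) ?u ?v"
      using \<phi> vert unfolding packing_coloring_def by (metis pverts_cycle_graph with_proj_simps(1))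
    also have "\<dots> \<le> ereal (real (nat d))"
      by (rule cycle_graph_dist_le[OF n])
    finally show False
      using d by auto
  qed
qed

section \<open>Colorings of the path left by deleting a vertex\<close>

definition packing_segment :: "(nat \<Rightarrow> nat) \<Rightarrow> nat \<Rightarrow> (nat \<Rightarrow> nat) \<Rightarrow> bool" where
  "packing_segment S m f \<longleftrightarrow> (\<forall>i j. i < j \<longrightarrow> j < m \<longrightarrow> f i = f j \<longrightarrow> S (f i) < j - i)"

text \<open>The term \<open>?q x\<close> is the position of \<open>x\<close> on the remaining path,
  starting with 0 at the successor of \<open>v\<close>. It serves as potential for the lower bound
  on distances.\<close>

lemma packing_coloring_del_vertI:
  assumes n: "n \<ge> 3" and v: "v < n"
    and f: "packing_segment S (n - 1) f" "\<And>i. i < n - 1 \<Longrightarrow> f i \<in> {1..k}"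
  shows "packing_coloring S (pre_digraph.del_vert (with_proj (cycle_graph n)) v) k
           (\<lambda>x. f (nat ((int x - int v - 1) mod int n)))"
    (is "packing_coloring S ?G k (\<lambda>x. f (nat (?q x)))")
proof -
  have wf: "wf_digraph ?G"
    by (rule wf_digraph_cycle_graph_del_vert[OF n])
  have q0: "0 \<le> ?q x" "?q x < int n" for x
    using n by auto
  \<comment> \<open>Position \<open>n - 1\<close> belongs to the deleted vertex alone.\<close>
  have last: "?q x \<noteq> int n - 1" if "x < n" "x \<noteq> v" for x
  proof
    assume "?q x = int n - 1"
    then have "(?q x + (1 + int v)) mod int n = int v mod int n"
      by simp
    moreover have "(?q x + (1 + int v)) mod int n = int x mod int n"
      by (simp add: mod_simps)
    ultimately show False
      using that v by simp
  qed
  have q: "nat (?q x) < n - 1" if "x < n" "x \<noteq> v" for x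
    using last[OF that] q0[of x] by linarith
  \<comment> \<open>Away from position \<open>n - 1\<close> nothing wraps around, so an arc moves
    the position by exactly 1.\<close>
  have step: "?q y = ?q x + 1"
    if "int y = (int x + 1) mod int n" "x < n" "x \<noteq> v" for x y
  proof -
    have "?q y = ((int x + 1) mod int n + (- int v - 1)) mod int n"
      unfolding that(1) by (simp add: algebra_simps)
    also have "\<dots> = (int x + 1 + (- int v - 1)) mod int n"
      by (rule mod_add_left_eq)
    also have "\<dots> = (?q x + 1) mod int n"
      by (simp add: mod_simps algebra_simps)
    also have "\<dots> = ?q x + 1"
      using last[OF that(2,3)] q0[of x] by (intro mod_pos_pos_trivial) linarith+
    finally show ?thesis .
  qed
  have inj: "x = y" if "?q x = ?q y" "x < n" "y < n" for x y
  proof -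
    have "(?q x + (1 + int v)) mod int n = (?q y + (1 + int v)) mod int n"
      using that(1) by simp
    then show ?thesis
      using that(2,3) by (simp add: mod_simps)
  qed
  have seg: "int (S (f a)) < \<bar>int a - int b\<bar>"
    if "a \<noteq> b" "a < n - 1" "b < n - 1" "f a = f b" for a b
  proof (cases "a < b")
    case True
    then have "S (f a) < b - a"
      using f(1) that unfolding packing_segment_def by blast
    with True show ?thesis
      by linarith
  next
    case False
    then have "S (f b) < a - b"
      using f(1) that unfolding packing_segment_def by (metis nat_neq_iff)
    with False that(4) show ?thesis
      by (metis abs_of_nat less_imp_of_nat_less linorder_not_less of_nat_diff)
  qed
  show ?thesis
    unfolding packing_coloring_def
  proof (intro conjI ballI allI impI)
    show "(\<lambda>x. f (nat (?q x))) \<in> verts ?G \<rightarrow> {1..k}"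
      using f(2) q by (fastforce simp: pre_digraph.del_vert_def)
    fix x y i
    assume "x \<in> verts ?G" "y \<in> verts ?G" "x \<noteq> y"
      and col: "f (nat (?q x)) = i" "f (nat (?q y)) = i"
    then have xy: "x < n" "x \<noteq> v" "y < n" "y \<noteq> v" "x \<noteq> y"
      by (auto simp: pre_digraph.del_vert_def)
    have "nat (?q x) \<noteq> nat (?q y)"
      using inj[of x y] xy q0[of x] q0[of y] by (metis eq_nat_nat_iff)
    with seg q[OF xy(1,2)] q[OF xy(3,4)] col
    have "int (S i) < \<bar>int (nat (?q x)) - int (nat (?q y))\<bar>"
      by metis
    then have "int (S i) < \<bar>?q x - ?q y\<bar>"
      using q0[of x] q0[of y] by simp
    show "ereal (real (S i)) < graph_dist ?G x y"
    proof (rule graph_dist_gt[OF wf])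
      fix p assume "pre_digraph.awalk ?G x p y"
      then have "\<bar>?q x - ?q y\<bar> \<le> int (length p)"
      proof (rule awalk_potential_bound[OF wf])
        fix a b assume "(a, b) \<in> arcs_ends ?G"
        then have "(a, b) \<in> parcs (cycle_graph n)" "a \<noteq> v" "b \<noteq> v"
          by (auto simp: arcs_ends_conv pre_digraph.del_vert_def)
        then show "\<bar>?q a - ?q b\<bar> \<le> 1"
          using step[of a b] step[of b a] by (auto simp: cycle_arc_iff)
      qed
      with \<open>int (S i) < \<bar>?q x - ?q y\<bar>\<close> show "S i < length p"
        by linarith
    qed
  qed
qed

text \<open>One deleted vertex is enough to refute criticality. With the last one removed, vertex
  names are already positions on the path.\<close>

lemma packing_coloring_del_vertD:
  assumes n: "n \<ge> 3"
    and \<phi>: "packing_coloring S (pre_digraph.del_vert (with_proj (cycle_graph n)) (n - 1)) k \<phi>"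
  shows "packing_segment S (n - 1) \<phi>" "\<And>i. i < n - 1 \<Longrightarrow> \<phi> i \<in> {1..k}"
proof -
  let ?G = "pre_digraph.del_vert (with_proj (cycle_graph n)) (n - 1)"
  have V: "x \<in> verts ?G \<longleftrightarrow> x < n - 1" for x
    using n by (auto simp: pre_digraph.del_vert_def)
  show "\<phi> i \<in> {1..k}" if "i < n - 1" for i
    using \<phi> that V[of i] by (auto simp: packing_coloring_def Pi_iff)
  show "packing_segment S (n - 1) \<phi>"
    unfolding packing_segment_def
  proof (intro allI impI)
    fix i j assume ij: "i < j" "j < n - 1" "\<phi> i = \<phi> j"
    have "graph_dist ?G (i + 0) (i + (j - i)) \<le> ereal (real (j - i))"
    proof (rule graph_dist_le[OF wf_digraph_cycle_graph_del_vert[OF n]])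
      fix l assume "l < j - i"
      then have "(i + l, i + Suc l) \<in> parcs (cycle_graph n)" "i + Suc l < n - 1"
        using ij by (auto simp: cycle_graph_def)
      then show "(i + l, i + Suc l) \<in> arcs_ends ?G"
        by (force simp: arcs_ends_conv pre_digraph.del_vert_def)
    qed (use V ij in simp)
    then have le: "graph_dist ?G i j \<le> ereal (real (j - i))"
      using ij(1) by (simp only: add_0_right le_add_diff_inverse less_imp_le)
    have "i \<in> verts ?G" "j \<in> verts ?G" "i \<noteq> j"
      using V ij by auto
    then have "ereal (real (S (\<phi> i))) < graph_dist ?G i j"
      using \<phi> ij(3) unfolding packing_coloring_def by metis
    from less_le_trans[OF this le] show "S (\<phi> i) < j - i"
      by (simp only: less_ereal.simps of_nat_less_iff)
  qed
qed

subsection \<open>Structure of colorings with at most four colors\<close>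

lemma packing_segment_shift:
  "packing_segment S m f \<Longrightarrow> k + l \<le> m \<Longrightarrow> packing_segment S l (\<lambda>i. f (k + i))"
  unfolding packing_segment_def
proof (intro allI impI)
  fix i j
  assume seg: "\<forall>i j. i < j \<longrightarrow> j < m \<longrightarrow> f i = f j \<longrightarrow> S (f i) < j - i"
    and "k + l \<le> m" "i < j" "j < l" "f (k + i) = f (k + j)"
  then have "S (f (k + i)) < k + j - (k + i)"
    by (intro seg[rule_format]) auto
  then show "S (f (k + i)) < j - i"
    by simp
qed

lemma packing_segmentD:
  "packing_segment S m f \<Longrightarrow> f (i + d) = f i \<Longrightarrow> 0 < d \<Longrightarrow> i + d < m \<Longrightarrow> S (f i) < d"
  unfolding packing_segment_def by (metis add_diff_cancel_left' less_add_same_cancel1)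

text \<open>Colors 1 and 2 would have to alternate, which puts two vertices of color 2 at distance
  2.\<close>

lemma packing_segment_two_colors:
  assumes "packing_segment S 4 f" "\<And>i. i < 4 \<Longrightarrow> f i \<in> {1, 2}" "1 \<le> S 1" "2 \<le> S 2"
  shows False
proof -
  have f: "f 0 \<in> {1, 2}" "f 1 \<in> {1, 2}" "f 2 \<in> {1, 2}" "f 3 \<in> {1, 2}"
    by (rule assms(2); simp)+
  have "f 1 \<noteq> f 0" "f 2 \<noteq> f 1" "f 3 \<noteq> f 2" "f 2 \<noteq> f 0 \<or> f 0 = 1" "f 3 \<noteq> f 1 \<or> f 1 = 1"
    using packing_segmentD[OF assms(1), of 0 1] packing_segmentD[OF assms(1), of 1 1]
      packing_segmentD[OF assms(1), of 2 1] packing_segmentD[OF assms(1), of 0 2]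
      packing_segmentD[OF assms(1), of 1 2] f assms(3,4)
    by (auto simp: numeral_2_eq_2 numeral_3_eq_3)
  with f show False
    by auto
qed

text \<open>Every window of four vertices contains color 3. The window right after an early vertex
  of color 3 gives a second one at distance at most 4.\<close>

lemma packing_segment_three_colors:
  assumes "packing_segment S 8 f" "\<And>i. i < 8 \<Longrightarrow> f i \<in> {1..3}" "1 \<le> S 1" "2 \<le> S 2" "4 \<le> S 3"
  shows False
proof -
  have ex: "\<exists>i<4. f (k + i) = 3" if "k \<le> 4" for k
  proof (rule ccontr)
    assume *: "\<not> (\<exists>i<4. f (k + i) = 3)"
    have "f (k + i) \<in> {1, 2}" if "i < 4" for i
      using * assms(2)[of "k + i"] \<open>k \<le> 4\<close> that by fastforce
    with packing_segment_shift[OF assms(1), of k 4] that assms(3,4) show False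
      by (intro packing_segment_two_colors[of S "\<lambda>i. f (k + i)"]) auto
  qed
  from ex[of 0] obtain i where i: "i < 4" "f i = 3"
    by auto
  with ex[of "Suc i"] obtain j where j: "j < 4" "f (Suc i + j) = 3"
    by auto
  then have "S (f i) < Suc j"
    using packing_segmentD[OF assms(1), of i "Suc j"] i by simp
  with i j assms(5) show False
    by simp
qed

lemma packing_map_apart:
  "packing_map S c \<Longrightarrow> c i = c j \<Longrightarrow> i < j \<Longrightarrow> int (S (c i)) < j - i"
  unfolding packing_map_def
  by (metis add.commute diff_add_cancel diff_gt_0_iff_gt linorder_not_less)

lemma packing_map_segment:
  assumes "packing_map S c"
  shows "packing_segment S m (\<lambda>j. c (i + int j))"
  unfolding packing_segment_def
proof (intro allI impI)
  fix j k assume "j < k" "k < m" "c (i + int j) = c (i + int k)"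
  with packing_map_apart[OF assms, of "i + int j" "i + int k"] show "S (c (i + int j)) < k - j"
    by linarith
qed

text \<open>The common setting of all classes: \<open>c\<close> will be the lift of a 4-coloring of
  a long cycle. Vertices of color 3 or 4 are the high ones, the others the low ones.\<close>

locale four_packing =
  fixes S :: "nat \<Rightarrow> nat" and c :: "int \<Rightarrow> nat"
  assumes S1: "1 \<le> S 1" and S2: "2 \<le> S 2" and S3: "4 \<le> S 3" and S4: "4 \<le> S 4"
    and packing: "packing_map S c" and colors: "\<And>i. c i \<in> {1..4}"
begin

lemmas apart = packing_map_apart[OF packing] and segment = packing_map_segment[OF packing]

lemma low_iff: "c i \<in> {1, 2} \<longleftrightarrow> \<not> 3 \<le> c i"
  using colors[of i] by auto

lemma high_iff: "3 \<le> c i \<longleftrightarrow> c i = 3 \<or> c i = 4"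
  using colors[of i] by auto

text \<open>A block reaches from a high vertex to the next high one; \<open>7 - c i\<close>
  exchanges the colors 3 and 4.\<close>

definition block :: "int \<Rightarrow> nat \<Rightarrow> bool" where
  "block i a \<longleftrightarrow> 3 \<le> c i \<and> a \<in> {1..4} \<and> c (i + int a) = 7 - c i \<and>
     (\<forall>j. 0 < j \<longrightarrow> j < a \<longrightarrow> c (i + int j) \<in> {1, 2})"

lemma blockD:
  assumes "block i a"
  shows "3 \<le> c i" "3 \<le> c (i + int a)" "1 \<le> a" "a \<le> 4" "c i = 4 \<Longrightarrow> c (i + int a) = 3"
    "c i = 3 \<Longrightarrow> c (i + int a) = 4"
  using assms colors[of i] by (auto simp: block_def)

lemma block_low:
  assumes "block i a" "0 < d" "d < int a"
  shows "c (i + d) \<in> {1, 2}"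
proof -
  have "c (i + int (nat d)) \<in> {1, 2}"
    using assms unfolding block_def by (metis nat_less_iff zero_less_nat_eq order_less_imp_le)
  with assms(2) show ?thesis
    by simp
qed

text \<open>Four low vertices in a row are impossible, so the next high vertex is at distance at
  most 4; as \<open>S 3\<close> and \<open>S 4\<close> are at least 4, it has the other high
  color.\<close>

lemma next_block:
  assumes "3 \<le> c i"
  shows "\<exists>a. block i a"
proof -
  have "\<exists>j. j < 4 \<and> 3 \<le> c (i + 1 + int j)"
    using packing_segment_two_colors[OF segment[of 4 "i + 1"] _ S1 S2] low_iff by blast
  then obtain j where j: "j < 4" "3 \<le> c (i + 1 + int j)"
    by blast
  define a where "a = (LEAST a. 0 < a \<and> 3 \<le> c (i + int a))"
  have ex: "0 < Suc j \<and> 3 \<le> c (i + int (Suc j))"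
    using j by (simp add: add.assoc)
  have a: "0 < a \<and> 3 \<le> c (i + int a)"
    unfolding a_def using LeastI[of "\<lambda>a. 0 < a \<and> 3 \<le> c (i + int a)", OF ex] .
  have "a \<le> Suc j"
    unfolding a_def using Least_le[of "\<lambda>a. 0 < a \<and> 3 \<le> c (i + int a)", OF ex] .
  then have "a \<le> 4"
    using j by simp
  have low: "c (i + int k) \<in> {1, 2}" if "0 < k" "k < a" for k
    using not_less_Least[of k "\<lambda>a. 0 < a \<and> 3 \<le> c (i + int a)"] that low_iff
    unfolding a_def by blast
  have "c (i + int a) \<noteq> c i"
  proof
    assume "c (i + int a) = c i"
    then have "int (S (c i)) < int a"
      using apart[of i "i + int a"] a by simp
    with \<open>a \<le> 4\<close> S3 S4 assms show False
      by (auto simp: high_iff)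
  qed
  with a assms have "c (i + int a) = 7 - c i"
    by (auto simp: high_iff)
  with a \<open>a \<le> 4\<close> low assms show ?thesis
    unfolding block_def by (intro exI[of _ a]) auto
qed

text \<open>Reflection turns statements about the following block into statements about the
  preceding one.\<close>

lemma four_packing_mirror: "four_packing S (\<lambda>i. c (- i))"
proof
  show "packing_map S (\<lambda>i. c (- i))"
    unfolding packing_map_def
  proof (intro allI impI notI)
    fix i d assume d: "0 < d" "d \<le> int (S (c (- i)))" "c (- (i + d)) = c (- i)"
    with apart[of "- (i + d)" "- i"] show False
      by simp
  qed
qed (use S1 S2 S3 S4 colors in auto)

lemma previous_block:
  assumes "3 \<le> c i"
  shows "\<exists>a. block (i - int a) a"
proof -
  interpret m: four_packing S "\<lambda>i. c (- i)"
    by (rule four_packing_mirror)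
  obtain a where "m.block (- i) a"
    using m.next_block[of "- i"] assms by auto
  then have a: "a \<in> {1..4}" "c (i - int a) = 7 - c i"
    and low: "\<And>j. 0 < j \<Longrightarrow> j < a \<Longrightarrow> c (i - int j) \<in> {1, 2}"
    by (auto simp: m.block_def)
  have "c (i - int a + int j) \<in> {1, 2}" if "0 < j" "j < a" for j
    using low[of "a - j"] that by (simp add: algebra_simps)
  with a assms colors[of i] show ?thesis
    unfolding block_def by (intro exI[of _ a]) auto
qed

lemma two_blocks:
  assumes "block i a" "block (i + int a) b"
  shows "c (i + int a + int b) = c i" "S (c i) < a + b"
proof -
  show *: "c (i + int a + int b) = c i"
    using assms unfolding block_def high_iff by auto
  show "S (c i) < a + b"
    using apart[of i "i + int a + int b"] * blockD(3)[OF assms(1)] by linarith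
qed

text \<open>The first return to color 4 happens after exactly two blocks, so a gap between two
  vertices of color 4 is peeled off in pairs of blocks.\<close>

lemma four_gap_induct:
  fixes Q :: "nat \<Rightarrow> bool"
  assumes "c i = 4" "c (i + int N) = 4" "Q 0"
    and step: "\<And>i a b M. c i = 4 \<Longrightarrow> block i a \<Longrightarrow> block (i + int a) b \<Longrightarrow> Q M \<Longrightarrow> Q (a + b + M)"
  shows "Q N"
  using assms(1,2)
proof (induction N arbitrary: i rule: less_induct)
  case (less N)
  show ?case
  proof (cases "N = 0")
    case True
    then show ?thesis
      using \<open>Q 0\<close> by simp
  next
    case False
    obtain a where a: "block i a"
      using next_block[of i] less.prems by auto
    then obtain b where b: "block (i + int a) b"
      using next_block blockD(2) by blast
    have "a + b \<le> N"
    proof (rule ccontr)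
      \<comment> \<open>Strictly before the end of the second block only low colors and one 3 occur,
        so color 4 at offset \<open>N\<close> > 0 is impossible there.\<close>
      assume "\<not> a + b \<le> N"
      then consider "N < a" | "N = a" | "a < N" "N - a < b"
        by linarith
      then show False
      proof cases
        case 1
        then have "c (i + int N) \<in> {1, 2}"
          using a False by (auto simp: block_def)
        with less.prems(2) show False
          by simp
      next
        case 2
        with blockD(5)[OF a less.prems(1)] less.prems(2) show False
          by simp
      next
        case 3
        then have "c (i + int a + int (N - a)) \<in> {1, 2}"
          using b unfolding block_def by (metis zero_less_diff)
        with less.prems(2) 3 show False
          by simp
      qed
    qed
    then obtain M where M: "N = a + b + M"
      using le_Suc_ex by blast
    have "Q M"
    proof (rule less.IH)
      show "M < N"
        using M blockD(3)[OF a] by simp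
      show "c (i + int a + int b) = 4"
        using two_blocks(1)[OF a b] less.prems(1) by simp
      show "c (i + int a + int b + int M) = 4"
        using less.prems(2) M by (simp add: add.assoc)
    qed
    then show ?thesis
      using step[OF less.prems(1) a b] M by simp
  qed
qed

lemma ex_four: "\<exists>i. c i = 4"
proof (rule ccontr)
  assume "\<nexists>i. c i = 4"
  then have "c i \<in> {1..3}" for i
    using colors[of i] by (auto simp: le_less)
  then show False
    by (intro packing_segment_three_colors[OF segment[of 8 0] _ S1 S2 S3]) auto
qed

text \<open>Here \<open>m\<close> counts the pairs of blocks in the gap; each pair has length
  between \<open>Suc (S 4)\<close> and 8.\<close>

lemma four_gap_bounds:
  assumes "c i = 4" "c (i + int N) = 4"
  shows "\<exists>m. Suc (S 4) * m \<le> N \<and> N \<le> 8 * m"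
proof (rule four_gap_induct[OF assms])
  show "\<exists>m. Suc (S 4) * m \<le> 0 \<and> 0 \<le> 8 * m"
    by (intro exI[of _ 0]) simp
next
  fix i a b and M :: nat
  assume "c i = 4" and ab: "block i a" "block (i + int a) b"
    and "\<exists>m. Suc (S 4) * m \<le> M \<and> M \<le> 8 * m"
  then obtain m where "Suc (S 4) * m \<le> M" "M \<le> 8 * m"
    by blast
  moreover have "S 4 < a + b" "a + b \<le> 8"
    using two_blocks(2)[OF ab] blockD(4)[OF ab(1)] blockD(4)[OF ab(2)] \<open>c i = 4\<close> by auto
  ultimately have "Suc (S 4) * Suc m \<le> a + b + M \<and> a + b + M \<le> 8 * Suc m"
    by (auto simp: algebra_simps)
  then show "\<exists>m. Suc (S 4) * m \<le> a + b + M \<and> a + b + M \<le> 8 * m"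
    by blast
qed

text \<open>The two inner vertices of a block of length three use the colors 1 and 2. If the neighboring
  block next to the vertex of color 2 has length at least three, it contains another vertex of color 2
  at distance at most three.\<close>

lemma no_block_three:
  assumes "3 \<le> S 2" and "block (i - int a) a" "block i 3" "block (i + 3) b"
  shows "a < 3 \<or> b < 3"
proof (rule ccontr)
  assume "\<not> (a < 3 \<or> b < 3)"
  then have a: "3 \<le> a" and b: "3 \<le> b"
    by auto
  have low: "c (i + 1) \<in> {1, 2}" "c (i + 2) \<in> {1, 2}"
    using block_low[OF assms(3), of 1] block_low[OF assms(3), of 2] by simp_all
  have right: "c (i + 4) \<in> {1, 2}" "c (i + 5) \<in> {1, 2}"
    using block_low[OF assms(4), of 1] block_low[OF assms(4), of 2] b by (simp_all add: add.commute)
  have left: "c (i - 1) \<in> {1, 2}" "c (i - 2) \<in> {1, 2}"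
    using block_low[OF assms(2), of "int a - 1"] block_low[OF assms(2), of "int a - 2"] a by simp_all
  have one: "c j \<noteq> c k" if "c j \<in> {1, 2}" "k = j + 1" for j k
    using apart[of j k] S1 S2 that by auto
  have two: "c j \<noteq> 2" if "c k = 2" "j < k" "k \<le> j + 3" for j k
    using apart[of j k] assms(1) that by auto
  show False
  proof (cases "c (i + 1) = 2")
    case True
    then have "c (i - 1) = 1" "c (i - 2) = 1"
      using left two[of "i + 1" "i - 1"] two[of "i + 1" "i - 2"] by auto
    then show False
      using one[of "i - 2" "i - 1"] by simp
  next
    case False
    then have "c (i + 2) = 2"
      using low one[of "i + 1" "i + 2"] by auto
    then have "c (i + 4) = 1" "c (i + 5) = 1"
      using right two[of "i + 4" "i + 2"] two[of "i + 5" "i + 2"] by auto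
    then show False
      using one[of "i + 4" "i + 5"] by simp
  qed
qed

text \<open>Adjacent blocks have total length at least 6 and each has length at most 4. This
  excludes length 1 and makes both neighbors of a block of length 3 too long for
  \<open>no_block_three\<close>.\<close>

lemma block_even:
  assumes "3 \<le> S 2" "5 \<le> S 3" "5 \<le> S 4" "block i a"
  shows "even a"
proof -
  obtain a' where a': "block (i - int a') a'"
    using previous_block blockD(1)[OF assms(4)] by blast
  obtain b where b: "block (i + int a) b"
    using next_block blockD(2)[OF assms(4)] by blast
  have "6 \<le> a + b"
    using two_blocks(2)[OF assms(4) b] assms(2,3) blockD(1)[OF assms(4)] by (auto simp: high_iff)
  moreover have "6 \<le> a' + a"
    using two_blocks(2)[OF a', of a] assms(2-4) blockD(1)[OF a'] by (auto simp: high_iff)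
  ultimately have "2 \<le> a" "3 \<le> a' \<or> a \<noteq> 3" "3 \<le> b \<or> a \<noteq> 3"
    using blockD(4)[OF a'] blockD(4)[OF b] by auto
  moreover have "a \<noteq> 3 \<or> a' < 3 \<or> b < 3"
    using no_block_three[OF assms(1) a', of b] assms(4) b by auto
  ultimately have "a = 2 \<or> a = 4"
    using blockD(4)[OF assms(4)] by auto
  then show ?thesis
    by auto
qed

lemma four_gap_even:
  assumes "3 \<le> S 2" "5 \<le> S 3" "5 \<le> S 4" "c i = 4" "c (i + int N) = 4"
  shows "even N"
proof (rule four_gap_induct[OF assms(4,5)])
  fix i a b and M :: nat assume "block i a" "block (i + int a) b" "even M"
  with block_even[OF assms(1-3)] have "even a" "even b"
    by blast+
  with \<open>even M\<close> show "even (a + b + M)"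
    by simp
qed simp

text \<open>Two even lengths of at most 4 with sum above 6 must both be 4.\<close>

lemma four_gap_dvd_8:
  assumes "3 \<le> S 2" "5 \<le> S 3" "6 \<le> S 4" "c i = 4" "c (i + int N) = 4"
  shows "8 dvd N"
proof (rule four_gap_induct[OF assms(4,5)])
  fix i a b and M :: nat assume "c i = 4" and ab: "block i a" "block (i + int a) b" and "8 dvd M"
  have "even a" "even b" "a \<le> 4" "b \<le> 4"
    using block_even[OF assms(1,2)] assms(3) ab blockD(4) by auto
  moreover have "6 < a + b"
    using two_blocks(2)[OF ab] assms(3) \<open>c i = 4\<close> by simp
  ultimately have "a + b = 8"
    by presburger
  with \<open>8 dvd M\<close> show "8 dvd a + b + M"
    by simp
qed simp

text \<open>If all pairs of blocks from a 4 to the next have length at least 7, no block is shorter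
  than 3; then length 3 is excluded by its neighbors and all blocks have length 4.\<close>

lemma four_gap_dvd_8_of_long_gaps:
  assumes "3 \<le> S 2" "c i = 4" "c (i + int N) = 4"
    and long: "\<And>i d. c i = 4 \<Longrightarrow> c (i + int d) = 4 \<Longrightarrow> 0 < d \<Longrightarrow> 7 \<le> d"
  shows "8 dvd N"
proof -
  have ge3: "3 \<le> a" if a: "block i a" for i a
  \<comment> \<open>A block is the first or the second of a pair starting at color 4; its partner
    has length at most 4.\<close>
  proof (cases "c i = 4")
    case True
    obtain b where b: "block (i + int a) b"
      using next_block blockD(2)[OF a] by blast
    then have "7 \<le> a + b"
      using long[of i "a + b"] two_blocks(1)[OF a b] True blockD(3)[OF a] by (simp add: add.assoc)
    then show ?thesis
      using blockD(4)[OF b] by simp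
  next
    case False
    obtain a' where a': "block (i - int a') a'"
      using previous_block blockD(1)[OF a] by blast
    have "c (i - int a') = 4"
      using a' False blockD(1)[OF a] blockD(1,5,6)[OF a'] by (auto simp: high_iff)
    then have "7 \<le> a' + a"
      using long[of "i - int a'" "a' + a"] two_blocks(1)[OF a'] a blockD(3)[OF a]
      by (simp add: add.assoc)
    then show ?thesis
      using blockD(4)[OF a'] by simp
  qed
  have eq4: "a = 4" if a: "block i a" for i a
  proof -
    obtain a' where a': "block (i - int a') a'"
      using previous_block blockD(1)[OF a] by blast
    obtain b where b: "block (i + int a) b"
      using next_block blockD(2)[OF a] by blast
    have "a \<noteq> 3"
      using no_block_three[OF assms(1) a', of b] a b ge3[OF a'] ge3[OF b] by auto
    with ge3[OF a] blockD(4)[OF a] show ?thesis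
      by simp
  qed
  show ?thesis
  proof (rule four_gap_induct[OF assms(2,3)])
    fix i a b and M :: nat assume "block i a" "block (i + int a) b" "8 dvd M"
    with eq4 have "a = 4" "b = 4"
      by blast+
    with \<open>8 dvd M\<close> show "8 dvd a + b + M"
      by simp
  qed simp
qed

end

subsection \<open>Periodic colorings from cyclic words\<close>

text \<open>A finite, executable test that the periodic repetition of \<open>w\<close> is a packing
  map for the distances listed in \<open>s\<close>; \<open>s ! (j - 1)\<close> belongs to color
  \<open>j\<close>.\<close>

definition cyclic_packing :: "nat list \<Rightarrow> nat list \<Rightarrow> bool" where
  "cyclic_packing s w \<longleftrightarrow>
     (\<forall>i<length w. w ! i \<in> {1..length s} \<and>
        (\<forall>d\<in>{1..s ! (w ! i - 1)}. w ! ((i + d) mod length w) \<noteq> w ! i))"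

text \<open>Larger distances in \<open>s\<close> only strengthen the test, so one word serves every
  sequence bounded entrywise by \<open>s\<close>.\<close>

lemma cyclic_packing_map:
  assumes w: "cyclic_packing s w" "w \<noteq> []"
    and S: "\<And>j. j \<in> {1..length s} \<Longrightarrow> S j \<le> s ! (j - 1)"
  defines "c \<equiv> \<lambda>i. w ! nat (i mod int (length w))"
  shows "packing_map S c" "\<And>i. c i \<in> {1..length s}"
proof -
  have lt: "nat (i mod int (length w)) < length w" for i
    using w(2) by (simp add: nat_less_iff)
  show *: "c i \<in> {1..length s}" for i
    using w(1) lt unfolding cyclic_packing_def c_def by blast
  show "packing_map S c"
    unfolding packing_map_def
  proof (intro allI impI)
    fix i d assume d: "0 < d" "d \<le> int (S (c i))"
    have "nat d \<in> {1..s ! (c i - 1)}"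
      using d S[OF *[of i]] by auto
    then have "w ! ((nat (i mod int (length w)) + nat d) mod length w) \<noteq> c i"
      using w(1) lt unfolding cyclic_packing_def c_def by blast
    moreover have "int ((nat (i mod int (length w)) + nat d) mod length w) = (i + d) mod int (length w)"
      using w(2) d(1) by (simp add: zmod_int mod_simps)
    then have "(nat (i mod int (length w)) + nat d) mod length w = nat ((i + d) mod int (length w))"
      by (metis nat_int)
    ultimately show "c (i + d) \<noteq> c i"
      by (simp add: c_def)
  qed
qed

lemma cyclic_packing_coloring:
  assumes "cyclic_packing s w" "length w \<ge> 3"
    and "\<And>j. j \<in> {1..length s} \<Longrightarrow> S j \<le> s ! (j - 1)"
  shows "\<exists>\<phi>. packing_coloring S (with_proj (cycle_graph (length w))) (length s) \<phi>"
proof -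
  have "w \<noteq> []"
    using assms(2) by auto
  from packing_coloring_cycleI[OF assms(2) _ cyclic_packing_map[OF assms(1) this assms(3)]]
  show ?thesis
    by (auto simp del: o_apply)
qed

text \<open>The common prefix \<open>p\<close> makes words compatible, so that this set of lengths
  is closed under addition once \<open>p\<close> is as long as the largest distance.\<close>

definition cyclic_lengths :: "nat list \<Rightarrow> nat list \<Rightarrow> nat set" where
  "cyclic_lengths s p =
     {length w |w. cyclic_packing s w \<and> length p \<le> length w \<and> take (length p) w = p}"

lemma cyclic_lengthsI:
  "cyclic_packing s w \<Longrightarrow> take (length p) w = p \<Longrightarrow> length p \<le> length w \<Longrightarrow> length w = n \<Longrightarrow>
     n \<in> cyclic_lengths s p"
  unfolding cyclic_lengths_def by blast

text \<open>Looking past the end of either word reaches at most into the prefix \<open>p\<close>,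
  which is the same whichever word comes next. A clash in \<open>u @ v\<close> would thus already
  occur in cyclic \<open>u\<close> or cyclic \<open>v\<close>.\<close>

lemma cyclic_packing_append:
  assumes "cyclic_packing s u" "cyclic_packing s v"
    and "take (length p) u = p" "take (length p) v = p"
    and "length p \<le> length u" "length p \<le> length v" "\<And>x. x \<in> set s \<Longrightarrow> x \<le> length p"
  shows "cyclic_packing s (u @ v)"
  unfolding cyclic_packing_def
proof (intro allI impI conjI ballI)
  let ?K = "length p"
  have pre: "u ! e = p ! e" "v ! e = p ! e" if "e < ?K" for e
    using that assms(3,4) by (metis nth_take)+
  fix i assume i: "i < length (u @ v)"
  let ?x = "(u @ v) ! i"
  have ul: "u ! i \<in> {1..length s}" if "i < length u" for i
    using assms(1) that unfolding cyclic_packing_def by blast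
  have vl: "v ! i \<in> {1..length s}" if "i < length v" for i
    using assms(2) that unfolding cyclic_packing_def by blast
  show x: "?x \<in> {1..length s}"
    using i ul[of i] vl[of "i - length u"] by (auto simp: nth_append)
  fix d assume d: "d \<in> {1..s ! (?x - 1)}"
  have "s ! (?x - 1) \<in> set s"
    using x by (intro nth_mem) auto
  with assms(7) d have dK: "d \<le> ?K"
    by fastforce
  show "(u @ v) ! ((i + d) mod length (u @ v)) \<noteq> ?x"
  proof (cases "i < length u")
    case True
    then have *: "u ! ((i + d) mod length u) \<noteq> u ! i" "?x = u ! i"
      using assms(1) d unfolding cyclic_packing_def by (auto simp: nth_append)
    have "(u @ v) ! ((i + d) mod length (u @ v)) = u ! ((i + d) mod length u)"
    proof (cases "i + d < length u")
      case False
      \<comment> \<open>The overshoot \<open>e\<close> is read in \<open>v\<close> after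
        concatenation and in \<open>u\<close> cyclically; both give \<open>p ! e\<close>.\<close>
      define e where "e = i + d - length u"
      have e: "i + d = e + length u" "e < ?K"
        using False True dK by (auto simp: e_def)
      then have "e < length u" "e < length v"
        using assms(5,6) by auto
      with e pre show ?thesis
        by (simp add: nth_append add.commute)
    qed (simp add: nth_append)
    with * show ?thesis
      by simp
  next
    case False
    define j where "j = i - length u"
    have j: "i = length u + j" "j < length v"
      using False i by (auto simp: j_def)
    then have *: "v ! ((j + d) mod length v) \<noteq> v ! j" "?x = v ! j"
      using assms(2) d unfolding cyclic_packing_def by (auto simp: nth_append)
    have "(u @ v) ! ((i + d) mod length (u @ v)) = v ! ((j + d) mod length v)"
    proof (cases "j + d < length v")
      case True
      then show ?thesis
        using j by (simp add: nth_append add.assoc)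
    next
      case False
      \<comment> \<open>Now the end of \<open>v\<close> wraps around to \<open>u\<close>, again
        within the prefix.\<close>
      define e where "e = j + d - length v"
      have e: "j + d = e + length v" "e < ?K"
        using False j dK by (auto simp: e_def)
      then have "e < length u" "e < length v"
        using assms(5,6) by auto
      moreover have "i + d = e + length (u @ v)"
        using e(1) j(1) by simp
      ultimately show ?thesis
        using e pre by (simp add: nth_append)
    qed
    with * show ?thesis
      by simp
  qed
qed

lemma cyclic_lengths_add:
  assumes "a \<in> cyclic_lengths s p" "b \<in> cyclic_lengths s p" "\<And>x. x \<in> set s \<Longrightarrow> x \<le> length p"
  shows "a + b \<in> cyclic_lengths s p"
proof -
  obtain u v where u: "cyclic_packing s u" "length p \<le> length u" "take (length p) u = p" "a = length u"
    and v: "cyclic_packing s v" "length p \<le> length v" "take (length p) v = p" "b = length v"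
    using assms(1,2) unfolding cyclic_lengths_def by blast
  have "cyclic_packing s (u @ v)"
    using cyclic_packing_append[OF u(1) v(1) u(3) v(3) u(2) v(2)] assms(3) by blast
  then show ?thesis
    by (rule cyclic_lengthsI) (use u v in auto)
qed

lemma cyclic_lengths_coloring:
  assumes "n \<in> cyclic_lengths [a1, a2, a3, a4] p" "n \<ge> 3" "S 1 \<le> a1" "S 2 \<le> a2" "S 3 \<le> a3" "S 4 \<le> a4"
  shows "\<exists>\<phi>. packing_coloring S (with_proj (cycle_graph n)) 4 \<phi>"
proof -
  obtain w where w: "cyclic_packing [a1, a2, a3, a4] w" "n = length w"
    using assms(1) unfolding cyclic_lengths_def by blast
  have "S j \<le> [a1, a2, a3, a4] ! (j - 1)" if "j \<in> {1..length [a1, a2, a3, a4]}" for j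
  proof -
    have "j = 1 \<or> j = 2 \<or> j = 3 \<or> j = 4"
      using that by auto
    with assms show ?thesis
      by auto
  qed
  moreover have "length [a1, a2, a3, a4] = 4"
    by simp
  ultimately show ?thesis
    using cyclic_packing_coloring[OF w(1)] w(2) assms(2) by metis
qed

section \<open>Short cyclic words for each class\<close>

lemma base_words_1344:
  "{5, 6, 8} \<subseteq> cyclic_lengths [1, 3, 4, 4] [4, 1, 2, 1]"
proof -
  have "5 \<in> cyclic_lengths [1, 3, 4, 4] [4, 1, 2, 1]"
    by (rule cyclic_lengthsI[of _ "[4, 1, 2, 1, 3]"]; code_simp)
  moreover have "6 \<in> cyclic_lengths [1, 3, 4, 4] [4, 1, 2, 1]"
    by (rule cyclic_lengthsI[of _ "[4, 1, 2, 1, 3, 1]"]; code_simp)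
  moreover have "8 \<in> cyclic_lengths [1, 3, 4, 4] [4, 1, 2, 1]"
    by (rule cyclic_lengthsI[of _ "[4, 1, 2, 1, 3, 1, 2, 1]"]; code_simp)
  ultimately show ?thesis
    by blast
qed

lemma base_words_1255:
  "{6, 7, 8} \<subseteq> cyclic_lengths [1, 2, 5, 5] [4, 1, 2, 1, 3]"
proof -
  have "6 \<in> cyclic_lengths [1, 2, 5, 5] [4, 1, 2, 1, 3]"
    by (rule cyclic_lengthsI[of _ "[4, 1, 2, 1, 3, 1]"]; code_simp)
  moreover have "7 \<in> cyclic_lengths [1, 2, 5, 5] [4, 1, 2, 1, 3]"
    by (rule cyclic_lengthsI[of _ "[4, 1, 2, 1, 3, 1, 2]"]; code_simp)
  moreover have "8 \<in> cyclic_lengths [1, 2, 5, 5] [4, 1, 2, 1, 3]"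
    by (rule cyclic_lengthsI[of _ "[4, 1, 2, 1, 3, 1, 2, 1]"]; code_simp)
  ultimately show ?thesis
    by blast
qed

lemma base_words_1266:
  "{7, 8} \<subseteq> cyclic_lengths [1, 2, 6, 6] [4, 1, 2, 1, 3, 1]"
proof -
  have "7 \<in> cyclic_lengths [1, 2, 6, 6] [4, 1, 2, 1, 3, 1]"
    by (rule cyclic_lengthsI[of _ "[4, 1, 2, 1, 3, 1, 2]"]; code_simp)
  moreover have "8 \<in> cyclic_lengths [1, 2, 6, 6] [4, 1, 2, 1, 3, 1]"
    by (rule cyclic_lengthsI[of _ "[4, 1, 2, 1, 3, 1, 2, 1]"]; code_simp)
  ultimately show ?thesis
    by blast
qed

text \<open>Odd length is obtained from blocks of lengths 4, 2, 3, 4: the block of length 3 is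
  allowed because its neighbor has length 2.\<close>

lemma base_words_1345:
  "{6, 8, 13} \<subseteq> cyclic_lengths [1, 3, 4, 5] [4, 1, 2, 1, 3]"
proof -
  have "6 \<in> cyclic_lengths [1, 3, 4, 5] [4, 1, 2, 1, 3]"
    by (rule cyclic_lengthsI[of _ "[4, 1, 2, 1, 3, 1]"]; code_simp)
  moreover have "8 \<in> cyclic_lengths [1, 3, 4, 5] [4, 1, 2, 1, 3]"
    by (rule cyclic_lengthsI[of _ "[4, 1, 2, 1, 3, 1, 2, 1]"]; code_simp)
  moreover have "13 \<in> cyclic_lengths [1, 3, 4, 5] [4, 1, 2, 1, 3]"
    by (rule cyclic_lengthsI[of _ "[4, 1, 2, 1, 3, 1, 4, 2, 1, 3, 1, 2, 1]"]; code_simp)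
  ultimately show ?thesis
    by blast
qed

lemma base_words_1355:
  "{6, 8} \<subseteq> cyclic_lengths [1, 3, 5, 5] [4, 1, 2, 1, 3]"
proof -
  have "6 \<in> cyclic_lengths [1, 3, 5, 5] [4, 1, 2, 1, 3]"
    by (rule cyclic_lengthsI[of _ "[4, 1, 2, 1, 3, 1]"]; code_simp)
  moreover have "8 \<in> cyclic_lengths [1, 3, 5, 5] [4, 1, 2, 1, 3]"
    by (rule cyclic_lengthsI[of _ "[4, 1, 2, 1, 3, 1, 2, 1]"]; code_simp)
  ultimately show ?thesis
    by blast
qed

lemma cyclic_packing_1377: "cyclic_packing [1, 3, 7, 7] [4, 1, 2, 1, 3, 1, 2, 1]"
  by code_simp

lemma base_words_1377: "8 \<in> cyclic_lengths [1, 3, 7, 7] [4, 1, 2, 1, 3, 1, 2]"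
  using cyclic_packing_1377 by (rule cyclic_lengthsI) simp_all

section \<open>Lengths generated by concatenation\<close>

lemma cyclic_lengths_1344:
  assumes "10 \<le> n"
  shows "n \<in> cyclic_lengths [1, 3, 4, 4] [4, 1, 2, 1]"
  using assms
proof (induction n rule: less_induct)
  case (less n)
  let ?L = "cyclic_lengths [1, 3, 4, 4] [4, 1, 2, 1]"
  have add: "a + b \<in> ?L" if "a \<in> ?L" "b \<in> ?L" for a b
    by (rule cyclic_lengths_add[OF that]) auto
  have base: "5 \<in> ?L" "6 \<in> ?L" "8 \<in> ?L"
    using base_words_1344 by blast+
  \<comment> \<open>The five consecutive lengths 10 to 14 start a descent by 5.\<close>
  consider "n = 5 + 5" | "n = 5 + 6" | "n = 6 + 6" | "n = 5 + 8" | "n = 6 + 8" | "15 \<le> n"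
    using less.prems by linarith
  then show ?case
  proof cases
    case 6
    then have "n - 5 \<in> ?L"
      using less.prems by (intro less.IH) (simp; presburger)+
    then have "n - 5 + 5 \<in> ?L"
      by (rule add) (rule base)
    with 6 show ?thesis
      by simp
  qed (simp_all only: add base)
qed

lemma cyclic_lengths_1255:
  assumes "12 \<le> n" "n \<noteq> 17"
  shows "n \<in> cyclic_lengths [1, 2, 5, 5] [4, 1, 2, 1, 3]"
  using assms
proof (induction n rule: less_induct)
  case (less n)
  let ?L = "cyclic_lengths [1, 2, 5, 5] [4, 1, 2, 1, 3]"
  have add: "a + b \<in> ?L" if "a \<in> ?L" "b \<in> ?L" for a b
    by (rule cyclic_lengths_add[OF that]) auto
  have base: "6 \<in> ?L" "7 \<in> ?L" "8 \<in> ?L"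
    using base_words_1255 by blast+
  \<comment> \<open>Descent by 6; 23 is built directly since 23 - 6 is the exceptional 17.\<close>
  consider "n = 6 + 6" | "n = 6 + 7" | "n = 7 + 7" | "n = 7 + 8" | "n = 8 + 8" | "n = 7 + (8 + 8)"
    | "18 \<le> n" "n \<noteq> 23"
    using less.prems by linarith
  then show ?case
  proof cases
    case 7
    then have "n - 6 \<in> ?L"
      using less.prems by (intro less.IH) (simp; presburger)+
    then have "n - 6 + 6 \<in> ?L"
      by (rule add) (rule base)
    with 7 show ?thesis
      by simp
  qed (simp_all only: add base)
qed

lemma cyclic_lengths_1266:
  assumes "14 \<le> n" "n \<notin> {17, 18, 19, 20, 25, 26, 27, 33, 34, 41}"
  shows "n \<in> cyclic_lengths [1, 2, 6, 6] [4, 1, 2, 1, 3, 1]"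
  using assms
proof (induction n rule: less_induct)
  case (less n)
  let ?L = "cyclic_lengths [1, 2, 6, 6] [4, 1, 2, 1, 3, 1]"
  have add: "a + b \<in> ?L" if "a \<in> ?L" "b \<in> ?L" for a b
    by (rule cyclic_lengths_add[OF that]) auto
  have base: "7 \<in> ?L" "8 \<in> ?L"
    using base_words_1266 by blast+
  \<comment> \<open>Descent by 7, except at 24, 32, 40 and 48: subtracting 7 would give 17, 25, 33
    and 41, so 8 is subtracted.\<close>
  consider "n = 7 + 7" | "n = 7 + 8" | "n = 8 + 8" | "n \<in> {24, 32, 40, 48}"
    | "21 \<le> n" "n \<notin> {24, 32, 40, 48}"
    using less.prems by force
  then show ?case
  proof cases
    case 4
    then have "n - 8 \<in> ?L"
      using less.prems by (intro less.IH) (simp; presburger)+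
    then have "n - 8 + 8 \<in> ?L"
      by (rule add) (rule base)
    with 4 show ?thesis
      by auto
  next
    case 5
    then have "n - 7 \<in> ?L"
      using less.prems by (intro less.IH) (simp; presburger)+
    then have "n - 7 + 7 \<in> ?L"
      by (rule add) (rule base)
    with 5 show ?thesis
      by simp
  qed (simp_all only: add base)
qed

lemma cyclic_lengths_1345:
  assumes "12 \<le> n" "n \<notin> {15, 17, 23}"
  shows "n \<in> cyclic_lengths [1, 3, 4, 5] [4, 1, 2, 1, 3]"
  using assms
proof (induction n rule: less_induct)
  case (less n)
  let ?L = "cyclic_lengths [1, 3, 4, 5] [4, 1, 2, 1, 3]"
  have add: "a + b \<in> ?L" if "a \<in> ?L" "b \<in> ?L" for a b
    by (rule cyclic_lengths_add[OF that]) auto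
  have base: "6 \<in> ?L" "8 \<in> ?L" "13 \<in> ?L"
    using base_words_1345 by blast+
  \<comment> \<open>Descent by 6; 21 and 29 would lead to the exceptional 15 and 23.\<close>
  consider "n = 6 + 6" | "n = 13" | "n = 6 + 8" | "n = 8 + 8" | "n = 8 + 13" | "n = 8 + (8 + 13)"
    | "18 \<le> n" "n \<notin> {21, 29}"
    using less.prems by force
  then show ?case
  proof cases
    case 7
    then have "n - 6 \<in> ?L"
      using less.prems by (intro less.IH) (simp; presburger)+
    then have "n - 6 + 6 \<in> ?L"
      by (rule add) (rule base)
    with 7 show ?thesis
      by simp
  qed (simp_all only: add base)
qed

lemma cyclic_lengths_1355:
  assumes "12 \<le> n" "even n"
  shows "n \<in> cyclic_lengths [1, 3, 5, 5] [4, 1, 2, 1, 3]"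
  using assms
proof (induction n rule: less_induct)
  case (less n)
  let ?L = "cyclic_lengths [1, 3, 5, 5] [4, 1, 2, 1, 3]"
  have add: "a + b \<in> ?L" if "a \<in> ?L" "b \<in> ?L" for a b
    by (rule cyclic_lengths_add[OF that]) auto
  have base: "6 \<in> ?L" "8 \<in> ?L"
    using base_words_1355 by blast+
  consider "n = 6 + 6" | "n = 6 + 8" | "n = 8 + 8" | "18 \<le> n"
    using less.prems by fastforce
  then show ?case
  proof cases
    case 4
    then have "n - 6 \<in> ?L"
      using less.prems by (intro less.IH) (simp; presburger)+
    then have "n - 6 + 6 \<in> ?L"
      by (rule add) (rule base)
    with 4 show ?thesis
      by simp
  qed (simp_all only: add base)
qed

lemma cyclic_lengths_1377: "8 * Suc m \<in> cyclic_lengths [1, 3, 7, 7] [4, 1, 2, 1, 3, 1, 2]"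
proof (induction m)
  case (Suc m)
  then have "8 + 8 * Suc m \<in> cyclic_lengths [1, 3, 7, 7] [4, 1, 2, 1, 3, 1, 2]"
    by (intro cyclic_lengths_add base_words_1377) auto
  then show ?case
    by simp
qed (use base_words_1377 in simp)

subsection \<open>Criticality\<close>

text \<open>For \<open>n\<close> \<le> 4 deletion leaves at most 2 colors while the cycle needs 3;
  for 5 \<le> \<open>n\<close> \<le> 8 it leaves at most 3 while the cycle needs 4. From 9 on every
  punctured cycle needs exactly 4 or can be colored with 4, so the question is whether the cycle
  needs more.\<close>

lemma packing_vertex_critical_cycle_iff:
  assumes n: "n \<ge> 3" and S: "S 1 = 1" "S 2 \<in> {2, 3}" "4 \<le> S 3" "S 3 \<le> S 4" "S 4 \<le> 7"
  shows "packing_vertex_critical S (with_proj (cycle_graph n)) \<longleftrightarrow>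
           n \<le> 8 \<or> \<not> (\<exists>\<phi>. packing_coloring S (with_proj (cycle_graph n)) 4 \<phi>)"
proof -
  let ?C = "with_proj (cycle_graph n)"
  let ?P = "\<lambda>v. pre_digraph.del_vert ?C v"
  have chi_C: "packing_chromatic_number S ?C \<le> k \<longleftrightarrow> (\<exists>\<phi>. packing_coloring S ?C k \<phi>)" for k
    by (rule packing_chromatic_number_le_iff) simp
  have chi_P: "packing_chromatic_number S (?P v) \<le> k \<longleftrightarrow> (\<exists>\<phi>. packing_coloring S (?P v) k \<phi>)" for k v
    by (rule packing_chromatic_number_le_iff) (simp add: pre_digraph.del_vert_def)
  define w :: "nat list" where "w = [4, 1, 2, 1, 3, 1, 2, 1]"
  \<comment> \<open>The shift by 1 starts after the 4: the word begins 1 2 1 3 1 2 1, with two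
    colors on three vertices and three colors on seven.\<close>
  define f where "f i = w ! nat ((1 + int i) mod int (length w))" for i
  have "S j \<le> [1, 3, 7, 7] ! (j - 1)" if "j \<in> {1..length [1::nat, 3, 7, 7]}" for j
  proof -
    have "j = 1 \<or> j = 2 \<or> j = 3 \<or> j = 4"
      using that by auto
    with S show ?thesis
      by auto
  qed
  note map = cyclic_packing_map[OF cyclic_packing_1377, folded w_def, OF _ this]
  have f_seg: "packing_segment S m f" for m
    using packing_map_segment[OF map(1), of m 1] unfolding f_def by (simp add: w_def)
  have f4: "f i \<in> {1..4}" for i
    using map(2)[of "1 + int i"] unfolding f_def by (simp add: w_def)
  have f3: "f i \<in> {1..3}" if "i < 7" for i
  proof -
    have "i \<in> {0, 1, 2, 3, 4, 5, 6}"
      using that by auto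
    then show ?thesis
      by (auto simp: f_def w_def)
  qed
  have f2: "f i \<in> {1..2}" if "i < 3" for i
  proof -
    have "i \<in> {0, 1, 2}"
      using that by auto
    then show ?thesis
      by (auto simp: f_def w_def)
  qed
  have le4: "packing_chromatic_number S (?P v) \<le> 4" if "v < n" for v
    unfolding chi_P using packing_coloring_del_vertI[OF n that f_seg] f4 by blast
  have le3: "packing_chromatic_number S (?P v) \<le> 3" if "v < n" "n \<le> 8" for v
    unfolding chi_P using packing_coloring_del_vertI[OF n that(1) f_seg, of 3] f3 that(2) by fastforce
  have le2: "packing_chromatic_number S (?P v) \<le> 2" if "v < n" "n \<le> 4" for v
    unfolding chi_P using packing_coloring_del_vertI[OF n that(1) f_seg, of 2] f2 that(2) by fastforce
  have gt2: "\<not> packing_chromatic_number S ?C \<le> 2"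
    unfolding chi_C
  proof
    assume "\<exists>\<phi>. packing_coloring S ?C 2 \<phi>"
    then obtain \<phi> where \<phi>: "packing_coloring S ?C 2 \<phi>"
      by blast
    have "{1, 2} = {1..2 :: nat}"
      by auto
    then show False
      using packing_coloring_cycleD(2)[OF n \<phi>] n S
      by (intro packing_segment_two_colors[OF packing_map_segment[OF packing_coloring_cycleD(1)[OF n \<phi>], of 4 0]])
        auto
  qed
  \<comment> \<open>The window of eight may wrap around the cycle; the capped distance for color 3
    is still at least 4 as \<open>n - 1\<close> \<ge> 4.\<close>
  have gt3: "\<not> packing_chromatic_number S ?C \<le> 3" if "n \<ge> 5"
    unfolding chi_C
  proof
    assume "\<exists>\<phi>. packing_coloring S ?C 3 \<phi>"
    then obtain \<phi> where \<phi>: "packing_coloring S ?C 3 \<phi>"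
      by blast
    then show False
      using packing_coloring_cycleD(2)[OF n \<phi>] that S
      by (intro packing_segment_three_colors[OF packing_map_segment[OF packing_coloring_cycleD(1)[OF n \<phi>], of 8 0]])
        auto
  qed
  have P_gt3: "\<not> packing_chromatic_number S (?P (n - 1)) \<le> 3" if "n \<ge> 9"
    unfolding chi_P
  proof
    assume "\<exists>\<phi>. packing_coloring S (?P (n - 1)) 3 \<phi>"
    then obtain \<phi> where \<phi>: "packing_coloring S (?P (n - 1)) 3 \<phi>"
      by blast
    have "packing_segment S 8 (\<lambda>i. \<phi> (0 + i))"
      using packing_coloring_del_vertD(1)[OF n \<phi>] that by (intro packing_segment_shift) auto
    then show False
      using packing_coloring_del_vertD(2)[OF n \<phi>] that S
      by (intro packing_segment_three_colors[of S \<phi>]) auto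
  qed
  show ?thesis
  proof (cases "n \<le> 8")
    case True
    have "packing_chromatic_number S (?P v) < packing_chromatic_number S ?C" if "v < n" for v
      using le2[OF that] le3[OF that True] gt2 gt3 by (cases "n \<le> 4") auto
    with True show ?thesis
      by (simp add: packing_vertex_critical_def)
  next
    case False
    show ?thesis
    proof (cases "packing_chromatic_number S ?C \<le> 4")
      case True
      then have "packing_chromatic_number S ?C \<le> packing_chromatic_number S (?P (n - 1))"
        using P_gt3 False by linarith
      then have "\<not> packing_vertex_critical S ?C"
        using n unfolding packing_vertex_critical_def by (auto intro!: bexI[of _ "n - 1"])
      with True False chi_C show ?thesis
        by blast
    next
      case gt4: False
      have "packing_chromatic_number S (?P v) < packing_chromatic_number S ?C" if "v < n" for v
        using le4[OF that] gt4 by linarith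
      with gt4 chi_C show ?thesis
        by (auto simp: packing_vertex_critical_def)
    qed
  qed
qed

text \<open>Here \<open>n - 1\<close> \<ge> 8 exceeds all four distances, so the cap on the lifted
  coloring disappears.\<close>

lemma four_coloring_cycleE:
  assumes n: "n \<ge> 9" and S: "S 1 = 1" "S 2 \<in> {2, 3}" "4 \<le> S 3" "S 3 \<le> S 4" "S 4 \<le> 7"
    and "\<exists>\<phi>. packing_coloring S (with_proj (cycle_graph n)) 4 \<phi>"
  obtains c i where "four_packing S c" "\<And>j. c (j + int n) = c j" "c i = 4"
proof -
  have n3: "n \<ge> 3"
    using n by simp
  obtain \<phi> where \<phi>: "packing_coloring S (with_proj (cycle_graph n)) 4 \<phi>"
    using assms by blast
  define c where "c i = \<phi> (nat (i mod int n))" for i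
  note c = packing_coloring_cycleD[OF n3 \<phi>, folded c_def]
  have "S j \<le> n - 1" if "j \<in> {1..4}" for j
  proof -
    have "j = 1 \<or> j = 2 \<or> j = 3 \<or> j = 4"
      using that by auto
    with S n show ?thesis
      by auto
  qed
  then have "packing_map S c"
    using c(1,2) by (simp add: packing_map_def min_absorb1)
  then interpret four_packing S c
    using c(2) S by unfold_locales auto
  obtain i where "c i = 4"
    using ex_four by blast
  with that four_packing_axioms c(3) show ?thesis
    by blast
qed

subsection \<open>Four-colorability in each class of sequences\<close>

text \<open>One turn around the cycle is a gap of length \<open>n\<close> from a vertex of color 4
  to itself.\<close>

lemma four_coloring_cycle_bounds:
  assumes "n \<ge> 9" "S 1 = 1" "S 2 \<in> {2, 3}" "4 \<le> S 3" "S 3 \<le> S 4" "S 4 \<le> 7"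
    and "\<exists>\<phi>. packing_coloring S (with_proj (cycle_graph n)) 4 \<phi>"
  shows "\<exists>m. Suc (S 4) * m \<le> n \<and> n \<le> 8 * m"
proof -
  obtain c i where "four_packing S c" "\<And>j. c (j + int n) = c j" "c i = 4"
    using four_coloring_cycleE[OF assms] by blast
  then show ?thesis
    by (intro four_packing.four_gap_bounds[of S c i]) auto
qed

lemma four_colorable_x44:
  assumes "n \<ge> 9" "S 1 = 1" "S 2 \<in> {2, 3}" "S 3 = 4" "S 4 = 4"
  shows "(\<exists>\<phi>. packing_coloring S (with_proj (cycle_graph n)) 4 \<phi>) \<longleftrightarrow> 10 \<le> n"
proof
  assume "\<exists>\<phi>. packing_coloring S (with_proj (cycle_graph n)) 4 \<phi>"
  from four_coloring_cycle_bounds[OF assms(1-3) _ _ _ this] assms(4,5)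
  obtain m where "5 * m \<le> n" "n \<le> 8 * m"
    by auto
  \<comment> \<open>Since \<open>n\<close> \<ge> 9, the bound \<open>8 * m\<close> forces
    \<open>m\<close> \<ge> 2.\<close>
  with assms(1) show "10 \<le> n"
    by presburger
next
  assume "10 \<le> n"
  from cyclic_lengths_coloring[OF cyclic_lengths_1344[OF this], of S] assms
  show "\<exists>\<phi>. packing_coloring S (with_proj (cycle_graph n)) 4 \<phi>"
    by auto
qed

lemma four_colorable_12x5:
  assumes "n \<ge> 9" "S 1 = 1" "S 2 = 2" "4 \<le> S 3" "S 3 \<le> 5" "S 4 = 5"
  shows "(\<exists>\<phi>. packing_coloring S (with_proj (cycle_graph n)) 4 \<phi>) \<longleftrightarrow> 12 \<le> n \<and> n \<noteq> 17"
proof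
  assume "\<exists>\<phi>. packing_coloring S (with_proj (cycle_graph n)) 4 \<phi>"
  from four_coloring_cycle_bounds[OF assms(1,2) _ assms(4) _ _ this] assms(3,5,6)
  obtain m where "6 * m \<le> n" "n \<le> 8 * m"
    by auto
  \<comment> \<open>For \<open>m\<close> \<ge> 2 the intervals from \<open>6 * m\<close> to
    \<open>8 * m\<close> miss only 17 above 12.\<close>
  with assms(1) show "12 \<le> n \<and> n \<noteq> 17"
    by presburger
next
  assume "12 \<le> n \<and> n \<noteq> 17"
  with cyclic_lengths_coloring[OF cyclic_lengths_1255, of n S] assms
  show "\<exists>\<phi>. packing_coloring S (with_proj (cycle_graph n)) 4 \<phi>"
    by auto
qed

lemma four_colorable_12x6:
  assumes "n \<ge> 9" "S 1 = 1" "S 2 = 2" "4 \<le> S 3" "S 3 \<le> 6" "S 4 = 6"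
  shows "(\<exists>\<phi>. packing_coloring S (with_proj (cycle_graph n)) 4 \<phi>) \<longleftrightarrow>
           14 \<le> n \<and> n \<notin> {17, 18, 19, 20, 25, 26, 27, 33, 34, 41}"
proof
  assume "\<exists>\<phi>. packing_coloring S (with_proj (cycle_graph n)) 4 \<phi>"
  from four_coloring_cycle_bounds[OF assms(1,2) _ assms(4) _ _ this] assms(3,5,6)
  obtain m where m: "7 * m \<le> n" "n \<le> 8 * m"
    by auto
  with assms(1) have "14 \<le> n"
    by presburger
  \<comment> \<open>These are the holes between successive intervals from \<open>7 * m\<close> to
    \<open>8 * m\<close>, beginning with \<open>m = 2\<close>; the last one, 41, lies between 40 and
    42.\<close>
  moreover have "n \<notin> {17, 18, 19, 20, 25, 26, 27, 33, 34, 41}"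
    using m by (auto; presburger)
  ultimately show "14 \<le> n \<and> n \<notin> {17, 18, 19, 20, 25, 26, 27, 33, 34, 41}"
    by blast
next
  assume "14 \<le> n \<and> n \<notin> {17, 18, 19, 20, 25, 26, 27, 33, 34, 41}"
  with cyclic_lengths_coloring[OF cyclic_lengths_1266, of n S] assms
  show "\<exists>\<phi>. packing_coloring S (with_proj (cycle_graph n)) 4 \<phi>"
    by auto
qed

lemma four_colorable_1345:
  assumes "n \<ge> 9" "S 1 = 1" "S 2 = 3" "S 3 = 4" "S 4 = 5"
  shows "(\<exists>\<phi>. packing_coloring S (with_proj (cycle_graph n)) 4 \<phi>) \<longleftrightarrow>
           12 \<le> n \<and> n \<notin> {15, 17, 23}"
proof
  assume col: "\<exists>\<phi>. packing_coloring S (with_proj (cycle_graph n)) 4 \<phi>"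
  from four_coloring_cycle_bounds[OF assms(1,2) _ _ _ _ col] assms(3-5)
  obtain m where m: "6 * m \<le> n" "n \<le> 8 * m"
    by auto
  have "n \<noteq> 15 \<and> n \<noteq> 23"
  proof (rule ccontr)
    assume "\<not> (n \<noteq> 15 \<and> n \<noteq> 23)"
    then have n: "n = 15 \<or> n = 23"
      by blast
    obtain c i where c: "four_packing S c" "\<And>j. c (j + int n) = c j" "c i = 4"
      using four_coloring_cycleE[OF assms(1,2) _ _ _ _ col] assms(3-5) by auto
    interpret four_packing S c
      by fact
    have "7 \<le> d" if d: "c j = 4" "c (j + int d) = 4" "0 < d" for j d
    proof -
      obtain k where k: "6 * k \<le> d" "d \<le> 8 * k"
        using four_gap_bounds[OF d(1,2)] assms(5) by auto
      \<comment> \<open>After a gap of 6, the rest of the turn is a gap of 9 or 17, and neither lies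
        between \<open>6 * l\<close> and \<open>8 * l\<close> for any \<open>l\<close>.\<close>
      have "d \<noteq> 6"
      proof
        assume "d = 6"
        have "c (j + int 6 + int (n - 6)) = 4"
          using c(2)[of j] d(1) n by (auto simp: add.commute)
        then obtain l where "6 * l \<le> n - 6" "n - 6 \<le> 8 * l"
          using four_gap_bounds[of "j + int 6" "n - 6"] d(2) \<open>d = 6\<close> assms(5) by auto
        with n show False
          by presburger
      qed
      with k d(3) show ?thesis
        by presburger
    qed
    then have "8 dvd n"
      using c(2,3) assms(3) by (intro four_gap_dvd_8_of_long_gaps[of i]) auto
    with n show False
      by auto
  qed
  moreover have "12 \<le> n" "n \<noteq> 17"
    using m assms(1) by presburger+
  ultimately show "12 \<le> n \<and> n \<notin> {15, 17, 23}"
    by blast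
next
  assume "12 \<le> n \<and> n \<notin> {15, 17, 23}"
  with cyclic_lengths_coloring[OF cyclic_lengths_1345, of n S] assms
  show "\<exists>\<phi>. packing_coloring S (with_proj (cycle_graph n)) 4 \<phi>"
    by auto
qed

lemma four_colorable_1355:
  assumes "n \<ge> 9" "S 1 = 1" "S 2 = 3" "S 3 = 5" "S 4 = 5"
  shows "(\<exists>\<phi>. packing_coloring S (with_proj (cycle_graph n)) 4 \<phi>) \<longleftrightarrow> 12 \<le> n \<and> even n"
proof
  assume col: "\<exists>\<phi>. packing_coloring S (with_proj (cycle_graph n)) 4 \<phi>"
  from four_coloring_cycle_bounds[OF assms(1,2) _ _ _ _ col] assms(3-5)
  obtain m where m: "6 * m \<le> n" "n \<le> 8 * m"
    by auto
  then have "12 \<le> n"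
    using assms(1) by presburger
  obtain c i where "four_packing S c" "\<And>j. c (j + int n) = c j" "c i = 4"
    using four_coloring_cycleE[OF assms(1,2) _ _ _ _ col] assms(3-5) by auto
  then have "even n"
    using assms(3-5) by (intro four_packing.four_gap_even[of S c i]) auto
  with \<open>12 \<le> n\<close> show "12 \<le> n \<and> even n"
    by blast
next
  assume "12 \<le> n \<and> even n"
  with cyclic_lengths_coloring[OF cyclic_lengths_1355, of n S] assms
  show "\<exists>\<phi>. packing_coloring S (with_proj (cycle_graph n)) 4 \<phi>"
    by auto
qed

lemma four_colorable_dvd_8:
  assumes "n \<ge> 9" "S 1 = 1" "S 2 \<in> {2, 3}" "4 \<le> S 3" "S 3 \<le> S 4" "S 4 \<le> 7"
    and "S 4 = 7 \<or> S 2 = 3 \<and> 5 \<le> S 3 \<and> 6 \<le> S 4"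
  shows "(\<exists>\<phi>. packing_coloring S (with_proj (cycle_graph n)) 4 \<phi>) \<longleftrightarrow> 8 dvd n"
proof
  assume col: "\<exists>\<phi>. packing_coloring S (with_proj (cycle_graph n)) 4 \<phi>"
  show "8 dvd n"
    using assms(7)
  proof (elim disjE conjE)
    \<comment> \<open>Lower and upper bound on the length of a pair of blocks coincide.\<close>
    assume "S 4 = 7"
    with four_coloring_cycle_bounds[OF assms(1-6) col] obtain m where "8 * m \<le> n" "n \<le> 8 * m"
      by auto
    then show ?thesis
      by presburger
  next
    assume S: "S 2 = 3" "5 \<le> S 3" "6 \<le> S 4"
    obtain c i where "four_packing S c" "\<And>j. c (j + int n) = c j" "c i = 4"
      using four_coloring_cycleE[OF assms(1-6) col] by blast
    with S show ?thesis
      by (intro four_packing.four_gap_dvd_8[of S c i]) auto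
  qed
next
  assume "8 dvd n"
  then obtain m where "n = 8 * Suc m"
    using assms(1) by (metis dvdE mult_0_right not0_implies_Suc not_numeral_le_zero)
  with cyclic_lengths_coloring[OF cyclic_lengths_1377[of m], of S] assms
  show "\<exists>\<phi>. packing_coloring S (with_proj (cycle_graph n)) 4 \<phi>"
    by auto
qed

lemma seqs_with_prefix_4D:
  assumes "S \<in> seqs_with_prefix [a, b, c, d]"
  shows "S 1 = a" "S 2 = b" "S 3 = c" "S 4 = d"
proof -
  have "S j = [a, b, c, d] ! (j - 1)" if "j \<in> {1..4}" for j
    using assms that by (auto simp: seqs_with_prefix_def)
  from this[of 1] this[of 2] this[of 3] this[of 4] show "S 1 = a" "S 2 = b" "S 3 = c" "S 4 = d"
    by auto
qed

theorem theorem5p1: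
  fixes S :: "nat \<Rightarrow> nat" and n :: nat
  assumes "packing_sequence S" and "n \<ge> 3"
  shows
    "(S \<in> seqs_with_prefix [1, 2, 4, 4] \<or> S \<in> seqs_with_prefix [1, 3, 4, 4] \<longrightarrow>
        (packing_vertex_critical S (with_proj (cycle_graph n)) \<longleftrightarrow> n \<le> 9)) \<and>
     (S \<in> seqs_with_barred_prefix 1 2 4 5 \<longrightarrow>
        (packing_vertex_critical S (with_proj (cycle_graph n)) \<longleftrightarrow> n \<le> 11 \<or> n = 17)) \<and>
     (S \<in> seqs_with_barred_prefix 1 2 4 6 \<longrightarrow>
        (packing_vertex_critical S (with_proj (cycle_graph n)) \<longleftrightarrow>
           n \<le> 13 \<or> n \<in> {17, 18, 19, 20, 25, 26, 27, 33, 34, 41})) \<and>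
     (S \<in> seqs_with_prefix [1, 3, 4, 5] \<longrightarrow>
        (packing_vertex_critical S (with_proj (cycle_graph n)) \<longleftrightarrow>
           n \<le> 11 \<or> n \<in> {15, 17, 23})) \<and>
     (S \<in> seqs_with_prefix [1, 3, 5, 5] \<longrightarrow>
        (packing_vertex_critical S (with_proj (cycle_graph n)) \<longleftrightarrow> n \<le> 10 \<or> odd n)) \<and>
     (S \<in> seqs_with_barred_prefix 1 2 4 7 \<union> seqs_with_barred_prefix 1 3 4 7
           \<union> seqs_with_barred_prefix 1 3 5 6 \<longrightarrow>
        (packing_vertex_critical S (with_proj (cycle_graph n)) \<longleftrightarrow> n mod 8 \<noteq> 0 \<or> n = 8))"
proof -
  let ?crit = "packing_vertex_critical S (with_proj (cycle_graph n))"
  have crit: "?crit \<longleftrightarrow> n \<le> 8 \<or> \<not> P"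
    if "S 1 = 1" "S 2 \<in> {2, 3}" "4 \<le> S 3" "S 3 \<le> S 4" "S 4 \<le> 7"
      and "9 \<le> n \<Longrightarrow> (\<exists>\<phi>. packing_coloring S (with_proj (cycle_graph n)) 4 \<phi>) \<longleftrightarrow> P" for P
    using packing_vertex_critical_cycle_iff[OF assms(2) that(1-5)] that(6)
    by (cases "n \<le> 8") auto
  have i: "?crit \<longleftrightarrow> n \<le> 9" if "S 1 = 1" "S 2 \<in> {2, 3}" "S 3 = 4" "S 4 = 4"
  proof -
    have "?crit \<longleftrightarrow> n \<le> 8 \<or> \<not> 10 \<le> n"
      using that by (intro crit four_colorable_x44) auto
    then show ?thesis
      by auto
  qed
  have ii: "?crit \<longleftrightarrow> n \<le> 11 \<or> n = 17" if "S \<in> seqs_with_barred_prefix 1 2 4 5"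
  proof -
    have "?crit \<longleftrightarrow> n \<le> 8 \<or> \<not> (12 \<le> n \<and> n \<noteq> 17)"
      using that by (intro crit four_colorable_12x5) (auto simp: seqs_with_barred_prefix_def)
    then show ?thesis
      by auto
  qed
  have iii: "?crit \<longleftrightarrow> n \<le> 13 \<or> n \<in> {17, 18, 19, 20, 25, 26, 27, 33, 34, 41}"
    if "S \<in> seqs_with_barred_prefix 1 2 4 6"
  proof -
    have "?crit \<longleftrightarrow> n \<le> 8 \<or> \<not> (14 \<le> n \<and> n \<notin> {17, 18, 19, 20, 25, 26, 27, 33, 34, 41})"
      using that by (intro crit four_colorable_12x6) (auto simp: seqs_with_barred_prefix_def)
    also have "\<dots> \<longleftrightarrow> n \<le> 13 \<or> n \<in> {17, 18, 19, 20, 25, 26, 27, 33, 34, 41}"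
      by linarith
    finally show ?thesis .
  qed
  have iv: "?crit \<longleftrightarrow> n \<le> 11 \<or> n \<in> {15, 17, 23}" if "S \<in> seqs_with_prefix [1, 3, 4, 5]"
  proof -
    have "?crit \<longleftrightarrow> n \<le> 8 \<or> \<not> (12 \<le> n \<and> n \<notin> {15, 17, 23})"
      using seqs_with_prefix_4D[OF that] by (intro crit four_colorable_1345) auto
    also have "\<dots> \<longleftrightarrow> n \<le> 11 \<or> n \<in> {15, 17, 23}"
      by linarith
    finally show ?thesis .
  qed
  have v: "?crit \<longleftrightarrow> n \<le> 10 \<or> odd n" if "S \<in> seqs_with_prefix [1, 3, 5, 5]"
  proof -
    have "?crit \<longleftrightarrow> n \<le> 8 \<or> \<not> (12 \<le> n \<and> even n)"
      using seqs_with_prefix_4D[OF that] by (intro crit four_colorable_1355) auto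
    \<comment> \<open>The bound 12 becomes 10 because 11 is odd.\<close>
    then show ?thesis
      by presburger
  qed
  have vi: "?crit \<longleftrightarrow> n mod 8 \<noteq> 0 \<or> n = 8"
    if "S \<in> seqs_with_barred_prefix 1 2 4 7 \<union> seqs_with_barred_prefix 1 3 4 7
          \<union> seqs_with_barred_prefix 1 3 5 6"
  proof -
    have "?crit \<longleftrightarrow> n \<le> 8 \<or> \<not> 8 dvd n"
      using that by (intro crit four_colorable_dvd_8) (auto simp: seqs_with_barred_prefix_def)
    \<comment> \<open>Among 3 \<le> \<open>n\<close> \<le> 8 only 8 is a multiple of 8, hence the
      extra case \<open>n = 8\<close>.\<close>
    with assms(2) show ?thesis
      by presburger
  qed
  have "?crit \<longleftrightarrow> n \<le> 9"
    if "S \<in> seqs_with_prefix [1, 2, 4, 4] \<or> S \<in> seqs_with_prefix [1, 3, 4, 4]"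
    using that by (intro i) (auto dest: seqs_with_prefix_4D)
  with ii iii iv v vi show ?thesis
    by blast
qed

end
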